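(* Let $n,p\in\mathbb R$ with $0<p<n$, let $\alpha\in(-1,1)$ and let $N\in\mathbb N_0$. The differential operator $$\tilde D= \frac{d^2}{dx^2}(x^2-1)(x-\alpha)+\frac{d}{dx}\Big((n+3)x^2-\alpha(n+2)x-1+2(x-\alpha)\begin{pmatrix}0&1\\1&0\end{pmatrix}\Big)+\Big(-N(N+n+2)x+\alpha(n-2p)\begin{pmatrix}1&0\\0&0\end{pmatrix}+\begin{pmatrix}0&n-p+1\\ p+1&0\end{pmatrix}\Big),$$ acting from the right hand side, is symmetric with respect to the matrix valued inner product $$\langle P,Q\rangle_\alpha=\int_{-1}^\alpha P(x)W(x)Q^*(x)\,dx,$$ that is, $\langle P\tilde D,Q\rangle_\alpha=\langle P,Q\tilde D\rangle_\alpha$ for all nice functions $P,Q$.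
   Context: $W$ is the $2\times2$ matrix weight $$W(x)=W_{p,n}(x)=(1-x^2)^{\frac n2-1}\begin{pmatrix}p x^2+n-p&-nx\\-nx&(n-p)x^2+p\end{pmatrix}.$$ "Nice functions" are the real $2\times2$ matrix valued functions that are $C^\infty$ on the closed interval $[-1,\alpha]$. A differential operator $\frac{d^2}{dx^2}F_2(x)+\frac{d}{dx}F_1(x)+F_0(x)$ acts from the right hand side: it sends $f$ to $f''(x)F_2(x)+f'(x)F_1(x)+f(x)F_0(x)$; scalars are understood as multiples of the identity matrix. $A^*$ denotes the (conjugate) transpose. *)

theory Defs
  imports "HOL-Analysis.Analysis"
begin

definition mat2 :: "real \<Rightarrow> real \<Rightarrow> real \<Rightarrow> real \<Rightarrow> real^2^2" where
  "mat2 a b c d = vector [vector [a, b], vector [c, d]]"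

(* On a nondegenerate closed interval this is the two-sided derivative at interior points
   and the one-sided derivative at the end points. *)
definition deriv_within :: "real set \<Rightarrow> (real \<Rightarrow> 'a::real_normed_vector) \<Rightarrow> real \<Rightarrow> 'a" where
  "deriv_within S f = (\<lambda>x. vector_derivative f (at x within S))"

definition C_infinity_on :: "real set \<Rightarrow> (real \<Rightarrow> 'a::real_normed_vector) \<Rightarrow> bool" where
  "C_infinity_on S f \<longleftrightarrow>
     (\<forall>k. \<forall>x\<in>S. (deriv_within S ^^ k) f differentiable (at x within S))"

definition nice :: "real \<Rightarrow> (real \<Rightarrow> real^2^2) \<Rightarrow> bool" where
  "nice \<alpha> f \<longleftrightarrow> C_infinity_on {-1..\<alpha>} f"

definition W :: "real \<Rightarrow> real \<Rightarrow> real \<Rightarrow> real^2^2" where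
  "W p n x = (1 - x\<^sup>2) powr (n / 2 - 1) *\<^sub>R
     mat2 (p * x\<^sup>2 + n - p) (- n * x)
          (- n * x) ((n - p) * x\<^sup>2 + p)"

(* The entries are real, so the adjoint is the transpose. For nice P and Q the integrand is
   continuous on (-1, \<alpha>] and O((1 + x) powr (n / 2 - 1)) at -1, hence integrable for n > 0. *)
definition inner_alpha ::
    "real \<Rightarrow> real \<Rightarrow> real \<Rightarrow> (real \<Rightarrow> real^2^2) \<Rightarrow> (real \<Rightarrow> real^2^2) \<Rightarrow> real^2^2" where
  "inner_alpha p n \<alpha> P Q = integral {-1..\<alpha>} (\<lambda>x. P x ** W p n x ** transpose (Q x))"

definition right_diff_op ::
    "real set \<Rightarrow> (real \<Rightarrow> real^2^2) \<Rightarrow> (real \<Rightarrow> real^2^2) \<Rightarrow> (real \<Rightarrow> real^2^2) \<Rightarrow>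
     (real \<Rightarrow> real^2^2) \<Rightarrow> real \<Rightarrow> real^2^2" where
  "right_diff_op S F2 F1 F0 f = (\<lambda>x.
     deriv_within S (deriv_within S f) x ** F2 x + deriv_within S f x ** F1 x + f x ** F0 x)"

(* mat c is the scalar matrix c I. *)
definition D_tilde ::
    "real \<Rightarrow> real \<Rightarrow> real \<Rightarrow> nat \<Rightarrow> (real \<Rightarrow> real^2^2) \<Rightarrow> real \<Rightarrow> real^2^2" where
  "D_tilde p n \<alpha> N = right_diff_op {-1..\<alpha>}
     (\<lambda>x. mat ((x\<^sup>2 - 1) * (x - \<alpha>)))
     (\<lambda>x. mat ((n + 3) * x\<^sup>2 - \<alpha> * (n + 2) * x - 1) + (2 * (x - \<alpha>)) *\<^sub>R mat2 0 1 1 0)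
     (\<lambda>x. mat (- real N * (real N + n + 2) * x)
           + (\<alpha> * (n - 2 * p)) *\<^sub>R mat2 1 0 0 0
           + mat2 0 (n - p + 1) (p + 1) 0)"

definition symmetric_wrt ::
    "('f \<Rightarrow> bool) \<Rightarrow> ('f \<Rightarrow> 'f \<Rightarrow> 'm) \<Rightarrow> ('f \<Rightarrow> 'f) \<Rightarrow> bool" where
  "symmetric_wrt V ip D \<longleftrightarrow> (\<forall>P Q. V P \<longrightarrow> V Q \<longrightarrow> ip (D P) Q = ip P (D Q))"

end

theory Submission
  imports Defs
begin

text \<open>
  Write \<open>\<phi> = (x\<^sup>2 - 1)(x - \<alpha>)\<close>, \<open>w = (1 - x\<^sup>2)\<close> to the power \<open>n/2 - 1\<close>, \<open>V = \<phi> W\<close> and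
  \<open>A adj\<close> for the transpose of \<open>A\<close>. The operator is symmetric because the difference of the two
  integrands is an exact derivative, as for scalar Sturm--Liouville operators. If there is \<open>S\<close> with
  \<open>V' + S = F1 W\<close>, \<open>V' - S = W F1 adj\<close> and \<open>S' = F0 W - W F0 adj\<close>, then the integrands differ by
  the derivative of the bilinear concomitant \<open>P' V Q adj - P V Q' adj + P S Q adj\<close>
  (\<open>lagrange_identity\<close>). The first two equations have the sum \<open>2 V' = F1 W + W F1 adj\<close>, and
  together the three are the usual symmetry equations of a second-order matrix operator.

  The noncommuting part of the first-order coefficient is \<open>2 (x - \<alpha>) J\<close>, with \<open>J\<close> the swap
  matrix. The sum equation reduces to \<open>(x\<^sup>2 - 1) M' = 2 x M + J M + M J\<close>, where \<open>W = w M\<close>. Half the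
  difference of the first two gives \<open>S = (x - \<alpha>) w (J M - M J)\<close>. The diagonal entries of \<open>M\<close> differ
  by \<open>(n - 2 p)(1 - x\<^sup>2)\<close>, so \<open>S\<close>, like \<open>V\<close>, carries the factor \<open>\<alpha> - x\<close> times
  \<open>1 - x\<^sup>2\<close> to the power \<open>n/2\<close>. Both therefore vanish at \<open>-1\<close> (as \<open>n > 0\<close>) and at \<open>\<alpha>\<close>, and the
  integral of the derivative of the concomitant is \<open>0\<close>. The constant part of the zeroth-order
  coefficient is what makes the equation for \<open>S'\<close> hold (\<open>symmetry_equations\<close>); its scalar part
  cancels there, whence the arbitrary \<open>N\<close>.

  For \<open>n < 2\<close> the weight is unbounded at \<open>-1\<close>. There the concomitant is still continuous but need
  not be differentiable, so the fundamental theorem of calculus is used with derivatives in the open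
  interval only. Splitting the integral of the difference needs each integrand to be integrable
  (\<open>integrable_inner_alpha\<close>).
\<close>

section \<open>Matrix calculus\<close>

lemma bounded_bilinear_matrix_mult:
  "bounded_bilinear ((**) :: real^'k^'m \<Rightarrow> real^'n^'k \<Rightarrow> real^'n^'m)"
  unfolding bilinear_conv_bounded_bilinear [symmetric] bilinear_def linear_iff
  by (auto simp: matrix_matrix_mult_def vec_eq_iff sum.distrib sum_distrib_left algebra_simps)

lemma bounded_linear_transpose: "bounded_linear (transpose :: real^'n^'m \<Rightarrow> real^'m^'n)"
  unfolding linear_conv_bounded_linear [symmetric] linear_iff
  by (auto simp: transpose_def vec_eq_iff)

lemmas matrix_mult_linear =
  bounded_bilinear.add_left [OF bounded_bilinear_matrix_mult]
  bounded_bilinear.add_right [OF bounded_bilinear_matrix_mult]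
  bounded_bilinear.diff_left [OF bounded_bilinear_matrix_mult]
  bounded_bilinear.diff_right [OF bounded_bilinear_matrix_mult]
  bounded_bilinear.scaleR_left [OF bounded_bilinear_matrix_mult]
  bounded_bilinear.scaleR_right [OF bounded_bilinear_matrix_mult]

lemmas has_vector_derivative_matrix_mult =
  bounded_bilinear.has_vector_derivative [OF bounded_bilinear_matrix_mult]

lemmas has_vector_derivative_transpose =
  bounded_linear.has_vector_derivative [OF bounded_linear_transpose]

lemmas continuous_on_matrix_mult =
  bounded_bilinear.continuous_on [OF bounded_bilinear_matrix_mult]

lemmas continuous_on_transpose =
  bounded_linear.continuous_on [OF bounded_linear_transpose]

lemma matrix_mult_mat_right: "A ** mat c = c *\<^sub>R (A :: real^'n^'m)"
  by (simp add: matrix_matrix_mult_def mat_def vec_eq_iff if_distrib cong: if_cong)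

lemma transpose_add: "transpose (A + B) = transpose A + transpose (B :: real^'n^'m)"
  by (simp add: transpose_def vec_eq_iff)

lemma mat2_arith:
  "mat c = mat2 c 0 0 c"
  "mat2 a1 b1 c1 d1 + mat2 a2 b2 c2 d2 = mat2 (a1 + a2) (b1 + b2) (c1 + c2) (d1 + d2)"
  "mat2 a1 b1 c1 d1 - mat2 a2 b2 c2 d2 = mat2 (a1 - a2) (b1 - b2) (c1 - c2) (d1 - d2)"
  "k *\<^sub>R mat2 a1 b1 c1 d1 = mat2 (k * a1) (k * b1) (k * c1) (k * d1)"
  "mat2 a1 b1 c1 d1 ** mat2 a2 b2 c2 d2 =
     mat2 (a1 * a2 + b1 * c2) (a1 * b2 + b1 * d2) (c1 * a2 + d1 * c2) (c1 * b2 + d1 * d2)"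
  "transpose (mat2 a1 b1 c1 d1) = mat2 a1 c1 b1 d1"
  by (simp_all add: mat2_def vec_eq_iff forall_2 mat_def matrix_matrix_mult_def sum_2 transpose_def)

lemma mat2_eqI:
  "a1 = a2 \<Longrightarrow> b1 = b2 \<Longrightarrow> c1 = c2 \<Longrightarrow> d1 = d2 \<Longrightarrow> mat2 a1 b1 c1 d1 = mat2 a2 b2 c2 d2"
  by simp

text \<open>Differentiation and continuity of \<open>mat2\<close> follow from the vector space rules once it is
  written as a linear combination of constant matrices.\<close>

lemma mat2_basis:
  "mat2 a b c d = a *\<^sub>R mat2 1 0 0 0 + b *\<^sub>R mat2 0 1 0 0 + c *\<^sub>R mat2 0 0 1 0 + d *\<^sub>R mat2 0 0 0 1"
  by (simp add: mat2_arith)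

lemma has_vector_derivative_mat2:
  assumes "(a has_real_derivative a') (at x within X)" "(b has_real_derivative b') (at x within X)"
    and "(c has_real_derivative c') (at x within X)" "(d has_real_derivative d') (at x within X)"
  shows "((\<lambda>t. mat2 (a t) (b t) (c t) (d t)) has_vector_derivative mat2 a' b' c' d') (at x within X)"
  unfolding mat2_basis [of "a _"] mat2_basis [of a']
  by (auto intro!: derivative_eq_intros assms)

lemma continuous_on_mat2:
  assumes "continuous_on X a" "continuous_on X b" "continuous_on X c" "continuous_on X d"
  shows "continuous_on X (\<lambda>t. mat2 (a t) (b t) (c t) (d t))"
  unfolding mat2_basis [of "a _"] by (intro continuous_intros assms)

section \<open>The Lagrange identity\<close>

text \<open>
  The product rule applied to the concomitant produces \<open>P' V' Q adj\<close> and \<open>P V' Q' adj\<close> without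
  second derivatives, and \<open>S\<close> completes them to the first-order terms \<open>P' F1 W Q adj\<close> and
  \<open>P W (Q' F1) adj\<close>; the terms \<open>P' V Q' adj\<close> cancel.
\<close>

lemma lagrange_identity:
  fixes P Q V S :: "real \<Rightarrow> real^'n^'n" and F0 F1 W0 :: "real^'n^'n"
  assumes P: "(P has_vector_derivative P1 x) (at x within X)"
      "(P1 has_vector_derivative P2) (at x within X)"
    and Q: "(Q has_vector_derivative Q1 x) (at x within X)"
      "(Q1 has_vector_derivative Q2) (at x within X)"
    and V: "(V has_vector_derivative V') (at x within X)" "V x = c *\<^sub>R W0"
    and S: "(S has_vector_derivative S') (at x within X)"
    and first: "V' + S x = F1 ** W0" "V' - S x = W0 ** transpose F1"
    and zeroth: "S' = F0 ** W0 - W0 ** transpose F0"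
  shows "((\<lambda>t. P1 t ** V t ** transpose (Q t) - P t ** V t ** transpose (Q1 t)
              + P t ** S t ** transpose (Q t)) has_vector_derivative
           (P2 ** mat c + P1 x ** F1 + P x ** F0) ** W0 ** transpose (Q x)
           - P x ** W0 ** transpose (Q2 ** mat c + Q1 x ** F1 + Q x ** F0)) (at x within X)"
    (is "(?B has_vector_derivative ?D) _")
proof -
  note d = P Q V(1) S
  have "(?B has_vector_derivative
      (P1 x ** V x ** transpose (Q1 x) + (P1 x ** V' + P2 ** V x) ** transpose (Q x))
     - (P x ** V x ** transpose Q2 + (P x ** V' + P1 x ** V x) ** transpose (Q1 x))
     + (P x ** S x ** transpose (Q1 x) + (P x ** S' + P1 x ** S x) ** transpose (Q x)))
     (at x within X)"
    by (intro has_vector_derivative_add has_vector_derivative_diff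
        has_vector_derivative_matrix_mult has_vector_derivative_transpose d)
  also have "(P1 x ** V x ** transpose (Q1 x) + (P1 x ** V' + P2 ** V x) ** transpose (Q x))
     - (P x ** V x ** transpose Q2 + (P x ** V' + P1 x ** V x) ** transpose (Q1 x))
     + (P x ** S x ** transpose (Q1 x) + (P x ** S' + P1 x ** S x) ** transpose (Q x))
     = P2 ** V x ** transpose (Q x) - P x ** V x ** transpose Q2
       + P1 x ** (V' + S x) ** transpose (Q x) - P x ** (V' - S x) ** transpose (Q1 x)
       + P x ** S' ** transpose (Q x)"
    by (simp add: matrix_mult_linear)
  also have "\<dots> = ?D"
    unfolding first zeroth V(2)
    by (simp add: matrix_mult_linear matrix_mult_mat_right transpose_add transpose_scalar
        matrix_transpose_mul matrix_mul_assoc)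
  finally show ?thesis .
qed

section \<open>Nice functions\<close>

lemma nice_derivatives:
  assumes "nice \<alpha> f" "-1 < \<alpha>"
  defines "D \<equiv> deriv_within {-1..\<alpha>}"
  shows "\<And>x. x \<in> {-1..\<alpha>} \<Longrightarrow> (f has_vector_derivative D f x) (at x within {-1..\<alpha>})"
    and "\<And>x. x \<in> {-1..\<alpha>} \<Longrightarrow> (D f has_vector_derivative D (D f) x) (at x within {-1..\<alpha>})"
    and "continuous_on {-1..\<alpha>} f" "continuous_on {-1..\<alpha>} (D f)" "continuous_on {-1..\<alpha>} (D (D f))"
proof -
  have diff: "(D ^^ k) f differentiable (at x within {-1..\<alpha>})" if "x \<in> {-1..\<alpha>}" for k x
    using assms(1) that unfolding nice_def C_infinity_on_def D_def by blast
  have deriv: "((D ^^ k) f has_vector_derivative D ((D ^^ k) f) x) (at x within {-1..\<alpha>})"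
    if "x \<in> {-1..\<alpha>}" for k x
    using diff [OF that, of k] by (simp add: D_def deriv_within_def vector_derivative_works)
  have cont: "continuous_on {-1..\<alpha>} ((D ^^ k) f)" for k
    by (simp add: continuous_on_eq_continuous_within diff differentiable_imp_continuous_within)
  show "\<And>x. x \<in> {-1..\<alpha>} \<Longrightarrow> (f has_vector_derivative D f x) (at x within {-1..\<alpha>})"
    "\<And>x. x \<in> {-1..\<alpha>} \<Longrightarrow> (D f has_vector_derivative D (D f) x) (at x within {-1..\<alpha>})"
    using deriv [of _ 0] deriv [of _ 1] by simp_all
  show "continuous_on {-1..\<alpha>} f" "continuous_on {-1..\<alpha>} (D f)" "continuous_on {-1..\<alpha>} (D (D f))"
    using cont [of 0] cont [of 1] cont [of 2] by (simp_all add: numeral_2_eq_2)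
qed

lemma continuous_on_D_tilde:
  assumes "nice \<alpha> f" "-1 < \<alpha>"
  shows "continuous_on {-1..\<alpha>} (D_tilde p n \<alpha> N f)"
  unfolding D_tilde_def right_diff_op_def mat2_arith
  by (intro continuous_on_add continuous_on_matrix_mult continuous_on_mat2 continuous_intros
      nice_derivatives [OF assms])

section \<open>Integrability\<close>

text \<open>The only singularity is at \<open>-1\<close>: split \<open>1 - x\<^sup>2 = (1 - x)(1 + x)\<close>. The first factor stays
  away from \<open>0\<close> because \<open>\<alpha> < 1\<close>, and the power of the second is integrable since
  \<open>n/2 - 1 > -1\<close>.\<close>

lemma absolutely_integrable_weight:
  fixes n \<alpha> :: real
  assumes "0 < n" "-1 < \<alpha>" "\<alpha> < 1"
  shows "(\<lambda>x. (1 - x\<^sup>2) powr (n / 2 - 1)) absolutely_integrable_on {-1..\<alpha>}"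
proof -
  have "(\<lambda>x. x powr (n / 2 - 1)) integrable_on {0..\<alpha> + 1}"
    using has_integral_powr_from_0 [of "n / 2 - 1" "\<alpha> + 1"] assms by (auto simp: integrable_on_def)
  then have "(\<lambda>x. (x + 1) powr (n / 2 - 1)) integrable_on {-1..\<alpha>}"
    using integrable_shift_cbox [of "\<lambda>x. x powr (n / 2 - 1)" 0 "\<alpha> + 1" 1] by simp
  then have "(\<lambda>x. (x + 1) powr (n / 2 - 1)) absolutely_integrable_on {-1..\<alpha>}"
    by (rule nonnegative_absolutely_integrable_1) simp
  moreover have c: "continuous_on {-1..\<alpha>} (\<lambda>x. (1 - x) powr (n / 2 - 1))"
    using assms by (intro continuous_intros) auto
  ultimately have "(\<lambda>x. (1 - x) powr (n / 2 - 1) * (x + 1) powr (n / 2 - 1))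
      absolutely_integrable_on {-1..\<alpha>}"
    by (intro absolutely_integrable_bounded_measurable_product_real
        continuous_imp_measurable_on_sets_lebesgue compact_imp_bounded compact_continuous_image c)
      auto
  moreover have "(1 - x) powr (n / 2 - 1) * (x + 1) powr (n / 2 - 1) = (1 - x\<^sup>2) powr (n / 2 - 1)"
    if "x \<in> {-1..\<alpha>}" for x
    using that assms by (simp add: powr_mult [symmetric] power2_eq_square algebra_simps)
  ultimately show ?thesis
    using set_integrable_cong by (metis (no_types, lifting))
qed

lemma integrable_inner_alpha:
  fixes P Q :: "real \<Rightarrow> real^2^2"
  assumes "0 < n" "-1 < \<alpha>" "\<alpha> < 1" "continuous_on {-1..\<alpha>} P" "continuous_on {-1..\<alpha>} Q"
  shows "(\<lambda>x. P x ** W p n x ** transpose (Q x)) integrable_on {-1..\<alpha>}"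
proof -
  let ?M = "\<lambda>x. mat2 (p * x\<^sup>2 + n - p) (- n * x) (- n * x) ((n - p) * x\<^sup>2 + p)"
  let ?g = "\<lambda>x. P x ** ?M x ** transpose (Q x)"
  have c: "continuous_on {-1..\<alpha>} ?g"
    by (intro continuous_on_matrix_mult continuous_on_transpose continuous_on_mat2
        continuous_intros assms)
  have "bilinear (\<lambda>(A :: real^2^2) (k :: real). k *\<^sub>R A)"
    by (auto simp: bilinear_def linear_iff algebra_simps)
  then have "(\<lambda>x. (1 - x\<^sup>2) powr (n / 2 - 1) *\<^sub>R ?g x) absolutely_integrable_on {-1..\<alpha>}"
    by (rule absolutely_integrable_bounded_measurable_product [where f = ?g and h = "\<lambda>A k. k *\<^sub>R A"])
      (use assms c in \<open>auto intro!: absolutely_integrable_weight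
        continuous_imp_measurable_on_sets_lebesgue compact_imp_bounded compact_continuous_image\<close>)
  then show ?thesis
    unfolding W_def by (simp add: matrix_mult_linear set_lebesgue_integral_eq_integral(1))
qed

section \<open>The symmetry equations\<close>

text \<open>The product \<open>\<phi> W\<close>, with the factor \<open>1 - x\<^sup>2\<close> of \<open>\<phi>\<close> absorbed into the power, which makes
  the exponent positive and shows continuity and vanishing at \<open>-1\<close> even when \<open>W\<close> is unbounded.\<close>

definition leading_weight :: "real \<Rightarrow> real \<Rightarrow> real \<Rightarrow> real \<Rightarrow> real^2^2" where
  "leading_weight p n \<alpha> x = ((\<alpha> - x) * (1 - x\<^sup>2) powr (n / 2)) *\<^sub>R
     mat2 (p * x\<^sup>2 + n - p) (- n * x) (- n * x) ((n - p) * x\<^sup>2 + p)"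

text \<open>The skew-symmetric \<open>S = (F1 W - W F1 adj) / 2\<close>, in a form free of the singular power.\<close>

definition skew_weight :: "real \<Rightarrow> real \<Rightarrow> real \<Rightarrow> real \<Rightarrow> real^2^2" where
  "skew_weight p n \<alpha> x = ((n - 2 * p) * ((\<alpha> - x) * (1 - x\<^sup>2) powr (n / 2))) *\<^sub>R mat2 0 1 (-1) 0"

lemma powr_half_eq:
  assumes "\<bar>x\<bar> < (1::real)"
  shows "(1 - x\<^sup>2) powr (n / 2) = (1 - x\<^sup>2) * (1 - x\<^sup>2) powr (n / 2 - 1)"
proof -
  have "0 < 1 - x\<^sup>2" using assms by (simp add: abs_square_less_1)
  then show ?thesis by (simp add: powr_diff)
qed

lemma leading_weight_eq:
  assumes "\<bar>x\<bar> < 1"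
  shows "leading_weight p n \<alpha> x = ((x\<^sup>2 - 1) * (x - \<alpha>)) *\<^sub>R W p n x"
  unfolding leading_weight_def W_def powr_half_eq [OF assms] by (simp add: algebra_simps)

lemma has_derivative_scalar_factor:
  assumes "\<bar>x\<bar> < 1"
  shows "((\<lambda>x. (\<alpha> - x) * (1 - x\<^sup>2) powr (n / 2)) has_real_derivative
     (1 - x\<^sup>2) powr (n / 2 - 1) * (x\<^sup>2 - 1 - n * x * (\<alpha> - x))) (at x)"
proof -
  have "0 < 1 - x\<^sup>2" using assms by (simp add: abs_square_less_1)
  then have "((\<lambda>x. (\<alpha> - x) * (1 - x\<^sup>2) powr (n / 2)) has_real_derivative
     (\<alpha> - x) * (n / 2 * (1 - x\<^sup>2) powr (n / 2 - 1) * (- (2 * x))) - (1 - x\<^sup>2) powr (n / 2)) (at x)"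
    by (auto intro!: derivative_eq_intros)
  then show ?thesis
    unfolding powr_half_eq [OF assms] by (simp add: algebra_simps)
qed

text \<open>
  Every term is a polynomial multiple of \<open>w\<close>, since \<open>1 - x\<^sup>2\<close> to the power \<open>n/2\<close> is
  \<open>(1 - x\<^sup>2) w\<close>. Entry by entry, the equations become polynomial identities.
  In the last one, the upper right entry of \<open>W F0 adj - F0 W\<close> is
  \<open>(n - 2 p) w (1 - x\<^sup>2 - n x (x - \<alpha>))\<close>.
\<close>

lemma symmetry_equations:
  fixes n p \<alpha> x :: real and N :: nat
  assumes x: "\<bar>x\<bar> < 1"
  defines "F1 \<equiv> mat ((n + 3) * x\<^sup>2 - \<alpha> * (n + 2) * x - 1) + (2 * (x - \<alpha>)) *\<^sub>R mat2 0 1 1 0"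
    and "F0 \<equiv> mat (- real N * (real N + n + 2) * x)
           + (\<alpha> * (n - 2 * p)) *\<^sub>R mat2 1 0 0 0 + mat2 0 (n - p + 1) (p + 1) 0"
  obtains V' S' where
    "(leading_weight p n \<alpha> has_vector_derivative V') (at x)"
    "(skew_weight p n \<alpha> has_vector_derivative S') (at x)"
    "V' + skew_weight p n \<alpha> x = F1 ** W p n x"
    "V' - skew_weight p n \<alpha> x = W p n x ** transpose F1"
    "S' = F0 ** W p n x - W p n x ** transpose F0"
proof
  let ?w = "(1 - x\<^sup>2) powr (n / 2 - 1)"
  let ?M = "\<lambda>x. mat2 (p * x\<^sup>2 + n - p) (- n * x) (- n * x) ((n - p) * x\<^sup>2 + p)"
  let ?M' = "mat2 (2 * p * x) (- n) (- n) (2 * (n - p) * x)"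
  let ?q' = "?w * (x\<^sup>2 - 1 - n * x * (\<alpha> - x))"
  let ?V' = "((\<alpha> - x) * (1 - x\<^sup>2) powr (n / 2)) *\<^sub>R ?M' + ?q' *\<^sub>R ?M x"
  let ?S' = "((n - 2 * p) * ?q') *\<^sub>R mat2 0 1 (-1) 0"
  have M: "(?M has_vector_derivative ?M') (at x)"
    by (rule has_vector_derivative_mat2) (auto intro!: derivative_eq_intros)
  show "(leading_weight p n \<alpha> has_vector_derivative ?V') (at x)"
    unfolding leading_weight_def [abs_def]
    by (rule has_vector_derivative_scaleR [OF has_derivative_scalar_factor [OF x] M])
  show "(skew_weight p n \<alpha> has_vector_derivative ?S') (at x)"
    unfolding skew_weight_def [abs_def]
    by (rule has_vector_derivative_scaleR
        [OF DERIV_cmult [OF has_derivative_scalar_factor [OF x]] has_vector_derivative_const, simplified])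
  show "?V' + skew_weight p n \<alpha> x = F1 ** W p n x" "?V' - skew_weight p n \<alpha> x = W p n x ** transpose F1"
    unfolding skew_weight_def W_def F1_def powr_half_eq [OF x] mat2_arith
    by (intro mat2_eqI; algebra)+
  show "?S' = F0 ** W p n x - W p n x ** transpose F0"
    unfolding W_def F0_def mat2_arith by (intro mat2_eqI; algebra)
qed

lemma continuous_on_leading_weight_skew_weight:
  assumes "0 < n" "\<alpha> < 1"
  shows "continuous_on {-1..\<alpha>} (leading_weight p n \<alpha>)" "continuous_on {-1..\<alpha>} (skew_weight p n \<alpha>)"
proof -
  have "continuous_on {-1..\<alpha>} (\<lambda>x. (1 - x\<^sup>2) powr (n / 2))"
    using assms by (intro continuous_on_powr' continuous_intros) (auto simp: abs_square_le_1)
  note this [continuous_intros] continuous_on_mat2 [continuous_intros]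
  show "continuous_on {-1..\<alpha>} (leading_weight p n \<alpha>)" "continuous_on {-1..\<alpha>} (skew_weight p n \<alpha>)"
    unfolding leading_weight_def [abs_def] skew_weight_def [abs_def] by (intro continuous_intros)+
qed

section \<open>Symmetry of the operator\<close>

theorem theorem3p3:
  fixes n p \<alpha> :: real and N :: nat
  assumes "0 < p" and "p < n" and "-1 < \<alpha>" and "\<alpha> < 1"
  shows "symmetric_wrt (nice \<alpha>) (inner_alpha p n \<alpha>) (D_tilde p n \<alpha> N)"
  unfolding symmetric_wrt_def
proof (intro allI impI)
  fix P Q assume P: "nice \<alpha> P" and Q: "nice \<alpha> Q"
  have n: "0 < n" using assms by simp
  let ?D = "deriv_within {-1..\<alpha>}" and ?T = "D_tilde p n \<alpha> N"
  let ?V = "leading_weight p n \<alpha>" and ?S = "skew_weight p n \<alpha>"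
  note dP = nice_derivatives [OF P assms(3)] and dQ = nice_derivatives [OF Q assms(3)]
  define B where "B = (\<lambda>x. ?D P x ** ?V x ** transpose (Q x) - P x ** ?V x ** transpose (?D Q x)
     + P x ** ?S x ** transpose (Q x))"
  let ?f = "\<lambda>x. ?T P x ** W p n x ** transpose (Q x)"
  let ?g = "\<lambda>x. P x ** W p n x ** transpose (?T Q x)"
  have "(B has_vector_derivative ?f x - ?g x) (at x)" if x: "x \<in> {-1<..<\<alpha>}" for x
  proof -
    have x1: "\<bar>x\<bar> < 1" and [simp]: "at x within {-1..\<alpha>} = at x"
      using x assms by (auto simp: at_within_Icc_at)
    obtain V' S' where eqs: "(?V has_vector_derivative V') (at x)"
        "(?S has_vector_derivative S') (at x)"
        "V' + ?S x = (mat ((n + 3) * x\<^sup>2 - \<alpha> * (n + 2) * x - 1)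
            + (2 * (x - \<alpha>)) *\<^sub>R mat2 0 1 1 0) ** W p n x"
        "V' - ?S x = W p n x ** transpose (mat ((n + 3) * x\<^sup>2 - \<alpha> * (n + 2) * x - 1)
            + (2 * (x - \<alpha>)) *\<^sub>R mat2 0 1 1 0)"
        "S' = (mat (- real N * (real N + n + 2) * x) + (\<alpha> * (n - 2 * p)) *\<^sub>R mat2 1 0 0 0
            + mat2 0 (n - p + 1) (p + 1) 0) ** W p n x
          - W p n x ** transpose (mat (- real N * (real N + n + 2) * x)
            + (\<alpha> * (n - 2 * p)) *\<^sub>R mat2 1 0 0 0 + mat2 0 (n - p + 1) (p + 1) 0)"
      using symmetry_equations [OF x1] by metis
    have "x \<in> {-1..\<alpha>}" using x by auto
    from dP(1,2) [OF this] dQ(1,2) [OF this] show ?thesis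
      unfolding B_def D_tilde_def right_diff_op_def
      using lagrange_identity [OF _ _ _ _ eqs(1) leading_weight_eq [OF x1] eqs(2-5), of P "?D P" _ Q "?D Q"]
      by simp
  qed
  moreover have "continuous_on {-1..\<alpha>} B"
    unfolding B_def
    by (intro continuous_on_add continuous_on_diff continuous_on_matrix_mult
        continuous_on_transpose continuous_on_leading_weight_skew_weight dP dQ n assms)
  \<comment> \<open>Differentiability at \<open>-1\<close> can fail when \<open>n < 2\<close>, so only the open interval is used.\<close>
  ultimately have "((\<lambda>x. ?f x - ?g x) has_integral B \<alpha> - B (-1)) {-1..\<alpha>}"
    using assms by (intro fundamental_theorem_of_calculus_interior) auto
  \<comment> \<open>At \<open>-1\<close> the vanishing rests on \<open>0 powr (n / 2) = 0\<close>, which agrees with the limit as \<open>n > 0\<close>.\<close>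
  moreover have "B \<alpha> = 0" "B (-1) = 0"
    by (simp_all add: B_def leading_weight_def skew_weight_def)
  ultimately have "integral {-1..\<alpha>} (\<lambda>x. ?f x - ?g x) = 0"
    by (simp add: integral_unique)
  moreover have "?f integrable_on {-1..\<alpha>}" "?g integrable_on {-1..\<alpha>}"
    by (intro integrable_inner_alpha continuous_on_D_tilde dP dQ P Q n assms)+
  ultimately show "inner_alpha p n \<alpha> (?T P) Q = inner_alpha p n \<alpha> P (?T Q)"
    unfolding inner_alpha_def by (simp add: integral_diff)
qed

end
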